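(* Let $\mathfrak g:\mathrm{Sym}^2(\mathbb R^n)\to\mathbb R$ be a Gårding–Dirichlet polynomial of degree $m$. For $\theta\in(-m\frac\pi2,m\frac\pi2)$ let $\mathbf F_\theta^{\mathfrak g}=\{A\in\mathrm{Sym}^2(\mathbb R^n):\sum_{k=1}^m\arctan\lambda_k^{\mathfrak g}(A)\ge\theta\}$. Then the asymptotic subequation $\overrightarrow{\mathbf F}{}_\theta^{\mathfrak g}$ of $\mathbf F_\theta^{\mathfrak g}$ is given as follows. (1) If $\theta\in I_k=\left((m-2k)\frac\pi2,(m-2(k-1))\frac\pi2\right)$ for some $k\in\{1,\dots,m\}$, then $\overrightarrow{\mathbf F}{}_\theta^{\mathfrak g}=\mathbf\Lambda_k^{\mathfrak g}$. (2) If $\theta=\theta_k=(m-2k)\frac\pi2$ for some $k\in\{1,\dots,m-1\}$, then $\overrightarrow{\mathbf F}{}_{\theta_k}^{\mathfrak g}=\mathbf\Lambda_k^{\sigma_{m-1}^{\mathfrak g}}$.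
   Context: $\mathrm{Sym}^2(\mathbb R^n)$ is the space of real symmetric $n\times n$ matrices and $\mathcal P=\{A\ge0\}$. A homogeneous polynomial $\mathfrak g$ of degree $m$ on $\mathrm{Sym}^2(\mathbb R^n)$ is Gårding hyperbolic with respect to $I$ if $\mathfrak g(I)\neq0$ and for every $A$ all roots of $t\mapsto\mathfrak g(tI+A)$ are real. The negatives of these roots, in increasing order with multiplicity, are the Gårding eigenvalues $\lambda_1^{\mathfrak g}(A)\le\dots\le\lambda_m^{\mathfrak g}(A)$, so $\mathfrak g(tI+A)=\mathfrak g(I)\prod_{k=1}^m(t+\lambda_k^{\mathfrak g}(A))$. The Gårding cone is the open convex cone $\Gamma=\{A:\lambda_1^{\mathfrak g}(A)>0\}$. $\mathfrak g$ is a Gårding–Dirichlet polynomial if it is Gårding hyperbolic with respect to $I$ and $\mathcal P\subset\overline\Gamma$. The branches are $\mathbf\Lambda_k^{\mathfrak g}=\{A:\lambda_k^{\mathfrak g}(A)\ge0\}$, $k=1,\dots,m$. $\sigma_j^{\mathfrak g}(A)$ is the $j$-th elementary symmetric function of $\lambda_1^{\mathfrak g}(A),\dots,\lambda_m^{\mathfrak g}(A)$, i.e. $\mathfrak g(tI+A)=\mathfrak g(I)\left(t^m+\sigma_1^{\mathfrak g}(A)t^{m-1}+\dots+\sigma_m^{\mathfrak g}(A)\right)$. The polynomial $\sigma_{m-1}^{\mathfrak g}$ is homogeneous of degree $m-1$ and Gårding hyperbolic with respect to $I$; $\mathbf\Lambda_k^{\sigma_{m-1}^{\mathfrak g}}$,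 $k=1,\dots,m-1$, is the set of $A$ whose $k$-th ordered Gårding eigenvalue with respect to $\sigma_{m-1}^{\mathfrak g}$ (negative of a root of $t\mapsto\sigma_{m-1}^{\mathfrak g}(tI+A)$) is $\ge0$. For a closed set $\mathbf F\subset\mathrm{Sym}^2(\mathbb R^n)$ with $\mathbf F+\mathcal P\subset\mathbf F$ (a subequation), the asymptotic interior of $\mathbf F$ is the set of all $A$ for which there exist $\epsilon>0$ and $t_0$ such that $t(A-\epsilon I)\in\mathbf F$ for all $t\ge t_0$; the asymptotic subequation $\overrightarrow{\mathbf F}$ is the closure of the asymptotic interior. *)

theory Defs
  imports "HOL-Analysis.Analysis" "HOL-Computational_Algebra.Computational_Algebra"
begin

text \<open>
  Functions on symmetric matrices are represented by functions on all square matrices; only their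
  values on \<open>Sym2\<close> matter. Since \<open>Sym2\<close> is a closed subspace, closures taken in the full matrix
  space agree with closures taken in \<open>Sym2\<close>.
\<close>

definition Sym2 :: "(real^'n^'n) set" where
  "Sym2 = {A. transpose A = A}"

definition psd :: "(real^'n^'n) set" where
  "psd = {A \<in> Sym2. \<forall>x. x \<bullet> (A *v x) \<ge> 0}"

definition homogeneous_polynomial :: "nat \<Rightarrow> (real^'n^'n \<Rightarrow> real) \<Rightarrow> bool" where
  "homogeneous_polynomial m g \<longleftrightarrow>
     (\<exists>p. real_polynomial_function p \<and> (\<forall>A\<in>Sym2. g A = p A)) \<and>
     (\<forall>A\<in>Sym2. \<forall>t. g (t *\<^sub>R A) = t ^ m * g A)"

text \<open>
  The polynomial \<open>t \<mapsto> g (tI + A)\<close>. The description is only meaningful when this function of \<open>t\<close>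
  is polynomial; see \<open>poly_line_poly\<close> below.
\<close>

definition line_poly :: "(real^'n^'n \<Rightarrow> real) \<Rightarrow> real^'n^'n \<Rightarrow> real poly" where
  "line_poly g A = (THE p. \<forall>t. poly p t = g (t *\<^sub>R mat 1 + A))"

text \<open>The roots are taken in the complex numbers: \<open>proots\<close> of a real polynomial would miss the
  nonreal ones.\<close>

definition garding_hyperbolic :: "nat \<Rightarrow> (real^'n^'n \<Rightarrow> real) \<Rightarrow> bool" where
  "garding_hyperbolic m g \<longleftrightarrow>
     homogeneous_polynomial m g \<and> g (mat 1) \<noteq> 0 \<and>
     (\<forall>A\<in>Sym2. \<forall>z::complex. poly (map_poly of_real (line_poly g A)) z = 0 \<longrightarrow> z \<in> \<real>)"

definition garding_eigenvalues :: "(real^'n^'n \<Rightarrow> real) \<Rightarrow> real^'n^'n \<Rightarrow> real list" where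
  "garding_eigenvalues g A =
     sorted_list_of_multiset (image_mset uminus (proots (line_poly g A)))"

text \<open>Indexed from 1; meaningful for \<open>1 \<le> k \<le> degree\<close>.\<close>

definition garding_eigenvalue :: "(real^'n^'n \<Rightarrow> real) \<Rightarrow> nat \<Rightarrow> real^'n^'n \<Rightarrow> real" where
  "garding_eigenvalue g k A = garding_eigenvalues g A ! (k - 1)"

definition garding_cone :: "(real^'n^'n \<Rightarrow> real) \<Rightarrow> (real^'n^'n) set" where
  "garding_cone g = {A \<in> Sym2. garding_eigenvalue g 1 A > 0}"

definition garding_dirichlet :: "nat \<Rightarrow> (real^'n^'n \<Rightarrow> real) \<Rightarrow> bool" where
  "garding_dirichlet m g \<longleftrightarrow> garding_hyperbolic m g \<and> psd \<subseteq> closure (garding_cone g)"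

definition garding_branch :: "(real^'n^'n \<Rightarrow> real) \<Rightarrow> nat \<Rightarrow> (real^'n^'n) set" where
  "garding_branch g k = {A \<in> Sym2. garding_eigenvalue g k A \<ge> 0}"

definition garding_sigma :: "nat \<Rightarrow> (real^'n^'n \<Rightarrow> real) \<Rightarrow> nat \<Rightarrow> real^'n^'n \<Rightarrow> real" where
  "garding_sigma m g j A =
     (\<Sum>S | S \<subseteq> {1..m} \<and> card S = j. \<Prod>k\<in>S. garding_eigenvalue g k A)"

definition arctan_set :: "nat \<Rightarrow> (real^'n^'n \<Rightarrow> real) \<Rightarrow> real \<Rightarrow> (real^'n^'n) set" where
  "arctan_set m g \<theta> = {A \<in> Sym2. (\<Sum>k=1..m. arctan (garding_eigenvalue g k A)) \<ge> \<theta>}"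

definition asymptotic_interior :: "(real^'n^'n) set \<Rightarrow> (real^'n^'n) set" where
  "asymptotic_interior F =
     {A \<in> Sym2. \<exists>\<epsilon>>0. \<exists>t0. \<forall>t\<ge>t0. t *\<^sub>R (A - \<epsilon> *\<^sub>R mat 1) \<in> F}"

definition asymptotic_subequation :: "(real^'n^'n) set \<Rightarrow> (real^'n^'n) set" where
  "asymptotic_subequation F = closure (asymptotic_interior F)"

lemma line_poly_eqI:
  assumes "\<And>t. poly p t = g (t *\<^sub>R mat 1 + A)"
  shows "line_poly g A = p"
  unfolding line_poly_def
proof (rule the_equality)
  show "q = p" if "\<forall>t. poly q t = g (t *\<^sub>R mat 1 + A)" for q
    using that assms by (simp flip: poly_eq_poly_eq_iff add: fun_eq_iff)
qed (use assms in simp)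

lemma poly_line_poly:
  fixes g :: "real^'n^'n \<Rightarrow> real"
  assumes "homogeneous_polynomial m g" and A: "A \<in> Sym2"
  shows "poly (line_poly g A) t = g (t *\<^sub>R mat 1 + A)"
proof -
  obtain p where p: "real_polynomial_function p" "\<And>B. B \<in> Sym2 \<Longrightarrow> g B = p B"
    using assms(1) unfolding homogeneous_polynomial_def by blast
  have "polynomial_function (\<lambda>t::real. t *\<^sub>R (mat 1 :: real^'n^'n) + A)"
    by (intro polynomial_function_add polynomial_function_const
        polynomial_function_bounded_linear bounded_linear_scaleR_left)
  then have "real_polynomial_function (p \<circ> (\<lambda>t. t *\<^sub>R mat 1 + A))"
    using p(1) by (rule real_polynomial_function_compose)
  then obtain a n where "(p \<circ> (\<lambda>t. t *\<^sub>R mat 1 + A)) = (\<lambda>t. \<Sum>i\<le>n. a i * t ^ i)"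
    unfolding real_polynomial_function_iff_sum by blast
  then have a: "p (t *\<^sub>R mat 1 + A) = (\<Sum>i\<le>n. a i * t ^ i)" for t
    by (metis comp_apply)
  have sym: "t *\<^sub>R mat 1 + A \<in> Sym2" for t
    using A by (auto simp: Sym2_def transpose_def vec_eq_iff mat_def)
  have *: "poly (\<Sum>i\<le>n. monom (a i) i) t = g (t *\<^sub>R mat 1 + A)" for t
    by (simp add: poly_sum poly_monom a p(2)[OF sym])
  show ?thesis
    using line_poly_eqI[of _ g A, OF *] * by simp
qed

end

(* On the line s (A - e I) the Garding eigenvalues are s (lambda_j - e), so as s tends to infinity
   the arctangent sum tends to pi/2 times (number of positive - number of negative lambda_j - e).
   Away from the phases theta_k this limit decides, and the asymptotic interior is {lambda_k > 0}.
   At theta_k a tie occurs exactly when lambda_k < e < lambda_(k+1). It is broken by the first-order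
   term - (sum_j 1/(lambda_j - e)) / s, the logarithmic derivative of g(tI + A), whose numerator is
   g(I) sigma_(m-1)(tI + A); interlacing of the roots of a real-rooted polynomial and of its
   derivative identifies the sign of this term with that of mu_k - e, where mu_k is the k-th
   eigenvalue of sigma_(m-1). Closures are taken using continuity of the ordered eigenvalues. *)
theory Submission
  imports Defs "HOL-Real_Asymp.Real_Asymp"
begin

section \<open>Real-rooted polynomials and their derivatives\<close>

text \<open>The hypothesis says that \<open>p\<close> splits into linear factors over the field.
  Splitting off one root lowers both sides of it by one, so the quotient inherits it and induction
  on the degree applies.\<close>

lemma poly_eq_prod_proots:
  fixes p :: "'a::field poly"
  assumes "size (proots p) = degree p"
  shows "p = smult (lead_coeff p) (\<Prod>x\<in>#proots p. [:- x, 1:])"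
  using assms
proof (induction "degree p" arbitrary: p)
  case 0
  then have "proots p = {#}" by simp
  moreover obtain c where "p = [:c:]"
    using 0 degree_eq_zeroE by metis
  ultimately show ?case by simp
next
  case (Suc n)
  then have "proots p \<noteq> {#}" by auto
  then obtain r where "r \<in># proots p" by blast
  moreover have nz: "p \<noteq> 0" using Suc.hyps(2) by auto
  ultimately obtain q where q: "p = [:- r, 1:] * q"
    by (auto simp: poly_eq_0_iff_dvd)
  with nz have "q \<noteq> 0" by auto
  then have pq: "proots p = add_mset r (proots q)" "degree p = Suc (degree q)"
    using q by (simp_all add: proots_mult degree_mult_eq del: mult_pCons_left)
  have lc: "lead_coeff p = lead_coeff q"
    unfolding q lead_coeff_mult by simp
  then have "q = smult (lead_coeff q) (\<Prod>x\<in>#proots q. [:- x, 1:])"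
    using Suc pq by simp
  then have "p = [:- r, 1:] * smult (lead_coeff q) (\<Prod>x\<in>#proots q. [:- x, 1:])"
    using q by metis
  also have "\<dots> = smult (lead_coeff p) (\<Prod>x\<in>#proots p. [:- x, 1:])"
    unfolding lc pq(1) image_mset_add_mset prod_mset.add_mset mult_smult_right ..
  finally show ?case .
qed

lemma poly_map_poly_of_real_of_real:
  "poly (map_poly complex_of_real p) (of_real x) = of_real (poly p x)"
  by (induction p) (simp_all add: map_poly_pCons)

text \<open>The fundamental theorem of algebra supplies a complex root, which is real by hypothesis.
  Dividing out its linear factor leaves a quotient whose complex roots are among those of
  \<open>p\<close>, so the induction continues.\<close>

lemma size_proots_if_complex_roots_real:
  fixes p :: "real poly"
  assumes "p \<noteq> 0" and "\<And>z::complex. poly (map_poly of_real p) z = 0 \<Longrightarrow> z \<in> \<real>"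
  shows "size (proots p) = degree p"
  using assms
proof (induction "degree p" arbitrary: p)
  case 0
  then show ?case by (metis size_proots_le le_zero_eq)
next
  case (Suc n)
  have "degree (map_poly complex_of_real p) = degree p"
    by (rule degree_map_poly) auto
  then have "\<not> constant (poly (map_poly complex_of_real p))"
    using Suc.hyps(2) by (simp add: constant_degree)
  then obtain z where z: "poly (map_poly complex_of_real p) z = 0"
    using fundamental_theorem_of_algebra by blast
  then obtain r where "z = complex_of_real r"
    using Suc.prems(2) Reals_cases by blast
  with z have "poly p r = 0" by (simp add: poly_map_poly_of_real_of_real)
  then obtain q where q: "p = [:- r, 1:] * q"
    by (auto simp: poly_eq_0_iff_dvd)
  with Suc.prems have "q \<noteq> 0" by auto
  have "z \<in> \<real>" if "poly (map_poly of_real q) z = 0" for z :: complex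
  proof (rule Suc.prems(2))
    have "map_poly complex_of_real p = map_poly of_real [:- r, 1:] * map_poly of_real q"
      unfolding q by (rule poly_eqI) (simp add: coeff_map_poly coeff_mult del: mult_pCons_left)
    with that show "poly (map_poly of_real p) z = 0" by simp
  qed
  moreover have "degree p = Suc (degree q)" "proots p = add_mset r (proots q)"
    using q \<open>q \<noteq> 0\<close> by (simp_all add: proots_mult degree_mult_eq del: mult_pCons_left)
  ultimately show ?case using Suc \<open>q \<noteq> 0\<close> by simp
qed

lemma size_filter_proots:
  fixes p :: "'a::idom poly"
  assumes "p \<noteq> 0"
  shows "size (filter_mset P (proots p)) = (\<Sum>x | poly p x = 0 \<and> P x. order x p)"
  unfolding size_multiset_overloaded_eq using assms by (intro sum.cong) auto

text \<open>Roots are added in increasing order, and each new one yields a critical point in the gap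
  to its predecessor. Keeping \<open>Q\<close> disjoint from \<open>R\<close> allows these points to
  be counted separately from multiple roots of \<open>p\<close>.\<close>

lemma Rolle_roots:
  fixes p :: "real poly"
  assumes "finite R" and "\<And>x. x \<in> R \<Longrightarrow> poly p x = 0"
  shows "\<exists>Q. finite Q \<and> card R \<le> Suc (card Q) \<and> Q \<inter> R = {} \<and>
    (\<forall>x\<in>Q. poly (pderiv p) x = 0 \<and> (\<exists>a\<in>R. \<exists>b\<in>R. a < x \<and> x < b))"
  using assms
proof (induction rule: finite_linorder_max_induct)
  case empty
  then show ?case by (intro exI[of _ "{}"]) simp
next
  case (insert b R)
  then obtain Q where Q: "finite Q" "card R \<le> Suc (card Q)" "Q \<inter> R = {}"
    "\<And>x. x \<in> Q \<Longrightarrow> poly (pderiv p) x = 0 \<and> (\<exists>a\<in>R. \<exists>b\<in>R. a < x \<and> x < b)"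
    by force
  show ?case
  proof (cases "R = {}")
    case True
    then show ?thesis by (intro exI[of _ "{}"]) simp
  next
    case False
    define a where "a = Max R"
    have a: "a \<in> R" "\<And>x. x \<in> R \<Longrightarrow> x \<le> a"
      using False insert.hyps(1) by (simp_all add: a_def)
    then have "a < b" "poly p a = 0" "poly p b = 0" using insert by auto
    then obtain c where c: "a < c" "c < b" "poly (pderiv p) c = 0"
      using poly_MVT[of a b p] by auto
    \<comment> \<open>The earlier critical points lie below the largest earlier root
      \<open>a\<close>, so \<open>c\<close> is new.\<close>
    have "x < a" if "x \<in> Q" for x using Q(4)[OF that] a(2) by force
    then have "c \<notin> Q" using c(1) by force
    moreover have "c \<notin> R" "b \<notin> Q" "b \<notin> R" using a(2) c insert.hyps Q(4) by force+
    ultimately show ?thesis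
      using Q c a(1) insert.hyps(1)
      by (intro exI[of _ "insert c Q"]) (simp, blast)
  qed
qed

text \<open>A root of multiplicity r stays a root of the derivative with multiplicity at least r -
  1, and Rolle adds one root in each gap between distinct roots; an interval contains the gaps
  between its points. The whole line gives real-rootedness of the derivative, half-lines give
  interlacing.\<close>

lemma size_roots_pderiv_ge:
  fixes p :: "real poly"
  assumes "pderiv p \<noteq> 0" and S: "is_interval S"
  shows "size (filter_mset (\<lambda>x. x \<in> S) (proots p)) \<le> Suc (size (filter_mset (\<lambda>x. x \<in> S) (proots (pderiv p))))"
proof -
  have nz: "p \<noteq> 0" using assms by auto
  define R where "R = {x. poly p x = 0 \<and> x \<in> S}"
  define R' where "R' = {x. poly (pderiv p) x = 0 \<and> x \<in> S}"
  have fin: "finite R" "finite R'"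
    unfolding R_def R'_def using nz assms(1) by (auto intro: finite_subset[OF _ poly_roots_finite])
  have R0: "\<And>x. x \<in> R \<Longrightarrow> poly p x = 0" by (simp add: R_def)
  obtain Q where Q: "finite Q" "card R \<le> Suc (card Q)" "Q \<inter> R = {}"
    "\<And>x. x \<in> Q \<Longrightarrow> poly (pderiv p) x = 0 \<and> (\<exists>a\<in>R. \<exists>b\<in>R. a < x \<and> x < b)"
    using Rolle_roots[OF fin(1) R0] by blast
  have "x \<in> R'" if x: "x \<in> Q" for x
  proof -
    obtain a b where "a \<in> S" "b \<in> S" "a \<le> x" "x \<le> b"
      using Q(4)[OF x] less_imp_le unfolding R_def by blast
    with S have "x \<in> S" unfolding is_interval_1 by blast
    with Q(4)[OF x] show ?thesis by (simp add: R'_def)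
  qed
  then have QR: "Q \<subseteq> R'" by auto
  have ord: "order x p \<le> Suc (order x (pderiv p))" for x
    using order_pderiv[of p x] assms(1) nz by (cases "poly p x = 0") (simp_all add: order_root)
  have RR': "order x (pderiv p) = 0" if "x \<in> R - R'" for x
    using that by (auto simp: R_def R'_def order_root)
  have "(\<Sum>x\<in>R. order x p) \<le> (\<Sum>x\<in>R. Suc (order x (pderiv p)))"
    by (intro sum_mono ord)
  also have "\<dots> = card R + (\<Sum>x\<in>R. order x (pderiv p))" by (simp add: sum_Suc)
  also have "(\<Sum>x\<in>R. order x (pderiv p)) = (\<Sum>x\<in>R \<inter> R'. order x (pderiv p))"
    using fin RR' by (intro sum.mono_neutral_right) auto
  \<comment> \<open>Since \<open>Q\<close> avoids \<open>R\<close>, multiple roots and Rolle points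
    occupy disjoint parts of \<open>R'\<close>; this leaves the orders on \<open>Q\<close> free to
    pay for \<open>card R\<close>.\<close>
  also have "\<dots> \<le> (\<Sum>x\<in>R' - Q. order x (pderiv p))"
    using fin Q(3) by (intro sum_mono2) auto
  also have "card R \<le> Suc (\<Sum>x\<in>Q. order x (pderiv p))"
  proof -
    have "1 \<le> order x (pderiv p)" if "x \<in> Q" for x
      using Q(4)[OF that] assms(1) order_root[of "pderiv p" x] by simp
    then have "(\<Sum>x\<in>Q. 1) \<le> (\<Sum>x\<in>Q. order x (pderiv p))" by (rule sum_mono)
    with Q(2) show ?thesis by simp
  qed
  finally have "(\<Sum>x\<in>R. order x p) \<le>
      Suc (\<Sum>x\<in>Q. order x (pderiv p)) + (\<Sum>x\<in>R' - Q. order x (pderiv p))"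
    by simp
  also have "\<dots> = Suc (\<Sum>x\<in>R'. order x (pderiv p))"
    using sum.subset_diff[OF QR fin(2), of "\<lambda>x. order x (pderiv p)"] by simp
  finally show ?thesis
    unfolding size_filter_proots[OF nz] size_filter_proots[OF assms(1)] R_def R'_def .
qed

section \<open>Ordered eigenvalues of a real-rooted pencil\<close>

text \<open>The factorization fixes the multiset of roots and monotonicity fixes the order of
  listing. Eigenvalues are computed below by exhibiting such a factorization.\<close>

lemma garding_eigenvalue_eqI:
  assumes eq: "\<And>t. h (t *\<^sub>R mat 1 + A) = c * (\<Prod>j=1..d. t + x j)"
    and "c \<noteq> 0" and mono: "mono_on {1..d} x" and k: "k \<in> {1..d}"
  shows "garding_eigenvalue h k A = x k"
proof -
  let ?p = "smult c (\<Prod>j=1..d. [:x j, 1:])"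
  have "line_poly h A = ?p"
    by (rule line_poly_eqI) (simp add: eq poly_prod add.commute[of "x _"])
  then have "proots (line_poly h A) = (\<Sum>j=1..d. {#- x j#})"
    using \<open>c \<noteq> 0\<close> by (simp add: proots_prod)
  also have "\<dots> = image_mset (\<lambda>j. - x j) (mset_set {1..d})"
    by (simp add: sum_unfold_sum_mset)
  also have "{1..d} = {1..<Suc d}" by auto
  finally have "image_mset uminus (proots (line_poly h A)) = mset (map x [1..<Suc d])"
    by (simp add: multiset.map_comp comp_def del: upt_Suc)
  moreover have "sorted (map x [1..<Suc d])"
    using mono by (auto simp: sorted_iff_nth_mono mono_on_def simp del: upt_Suc)
  ultimately have "garding_eigenvalues h A = map x [1..<Suc d]"
    unfolding garding_eigenvalues_def
    by (metis sorted_list_of_multiset_mset sorted_sort_id)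
  then show ?thesis
    using k by (auto simp: garding_eigenvalue_def simp del: upt_Suc)
qed

text \<open>The converse of \<open>garding_eigenvalue_eqI\<close>: when the restriction to the line
  splits over the reals, the sorted list of negated roots has exactly \<open>degree p\<close>
  entries, so every index from 1 to the degree is meaningful.\<close>

lemma
  assumes eq: "\<And>t. h (t *\<^sub>R mat 1 + A) = poly p t" and p: "size (proots p) = degree p"
  shows garding_eigenvalue_factorization:
      "h (t *\<^sub>R mat 1 + A) = lead_coeff p * (\<Prod>j=1..degree p. t + garding_eigenvalue h j A)"
    and mono_garding_eigenvalue: "mono_on {1..degree p} (\<lambda>j. garding_eigenvalue h j A)"
proof -
  let ?xs = "garding_eigenvalues h A"
  have lp: "line_poly h A = p"
    by (rule line_poly_eqI) (simp add: eq)
  have mset: "mset ?xs = image_mset uminus (proots p)"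
    by (simp add: garding_eigenvalues_def lp)
  then have len: "length ?xs = degree p"
    by (metis p size_image_mset size_mset)
  have "h (t *\<^sub>R mat 1 + A) = lead_coeff p * (\<Prod>x\<in>#proots p. t - x)"
    unfolding eq by (subst poly_eq_prod_proots[OF p]) (simp add: poly_prod_mset)
  also have "(\<Prod>x\<in>#proots p. t - x) = prod_list (map ((+) t) ?xs)"
    unfolding prod_mset_prod_list[symmetric] mset_map mset
    by (simp add: multiset.map_comp comp_def)
  also have "\<dots> = (\<Prod>i<degree p. t + ?xs ! i)"
    by (simp add: prod.list_conv_set_nth len atLeast0LessThan)
  also have "\<dots> = (\<Prod>j=1..degree p. t + garding_eigenvalue h j A)"
    unfolding garding_eigenvalue_def
    by (rule prod.reindex_bij_witness[of _ "\<lambda>j. j - 1" Suc]) auto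
  finally show "h (t *\<^sub>R mat 1 + A) =
      lead_coeff p * (\<Prod>j=1..degree p. t + garding_eigenvalue h j A)" .
  have "sorted ?xs"
    by (simp add: garding_eigenvalues_def)
  then show "mono_on {1..degree p} (\<lambda>j. garding_eigenvalue h j A)"
    unfolding garding_eigenvalue_def mono_on_def
    by (auto intro!: sorted_nth_mono simp: len)
qed

lemma Sym2_add: "A \<in> Sym2 \<Longrightarrow> B \<in> Sym2 \<Longrightarrow> A + B \<in> Sym2"
  and Sym2_diff: "A \<in> Sym2 \<Longrightarrow> B \<in> Sym2 \<Longrightarrow> A - B \<in> Sym2"
  and Sym2_scaleR: "A \<in> Sym2 \<Longrightarrow> s *\<^sub>R A \<in> Sym2"
  and Sym2_mat: "mat s \<in> Sym2"
  and Sym2_0: "0 \<in> Sym2"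
  by (auto simp: Sym2_def transpose_def vec_eq_iff mat_def)

lemmas Sym2_intros = Sym2_add Sym2_diff Sym2_scaleR Sym2_mat Sym2_0

lemma closed_Sym2: "closed (Sym2 :: (real^'n^'n) set)"
proof -
  have "continuous_on UNIV (transpose :: real^'n^'n \<Rightarrow> real^'n^'n)"
    unfolding transpose_def by (intro continuous_intros)
  then show ?thesis
    unfolding Sym2_def by (intro closed_Collect_eq continuous_intros)
qed

text \<open>Bolzano-Weierstrass is applied once per index, each time to the subsequence already
  chosen; limits found earlier survive.\<close>

lemma bounded_family_convergent_subsequence:
  fixes x :: "'i \<Rightarrow> nat \<Rightarrow> 'a::heine_borel"
  assumes "finite I" and "\<And>i. i \<in> I \<Longrightarrow> bounded (range (x i))"
  shows "\<exists>r y. strict_mono (r :: nat \<Rightarrow> nat) \<and> (\<forall>i\<in>I. (\<lambda>n. x i (r n)) \<longlonglongrightarrow> y i)"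
  using assms
proof induction
  case empty
  show ?case by (intro exI[of _ id]) (simp add: strict_mono_def)
next
  case (insert i I)
  then obtain r y where r: "strict_mono r" "\<And>j. j \<in> I \<Longrightarrow> (\<lambda>n. x j (r n)) \<longlonglongrightarrow> y j"
    by auto
  have "bounded (range (x i \<circ> r))"
    using insert.prems by (rule bounded_subset) auto
  then obtain l s where s: "strict_mono s" "((x i \<circ> r) \<circ> s) \<longlonglongrightarrow> l"
    using bounded_imp_convergent_subsequence by blast
  have "(\<lambda>n. x j (r (s n))) \<longlonglongrightarrow> (y(i := l)) j" if "j \<in> insert i I" for j
  proof (cases "j = i")
    case False
    with that r(2) have "((\<lambda>n. x j (r n)) \<circ> s) \<longlonglongrightarrow> y j"
      by (intro LIMSEQ_subseq_LIMSEQ s(1)) auto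
    with False show ?thesis by (simp add: comp_def)
  qed (use s(2) in \<open>simp add: comp_def\<close>)
  moreover have "strict_mono (\<lambda>n. r (s n))"
    using strict_mono_o[OF r(1) s(1)] by (simp only: comp_def)
  ultimately show ?case
    by (intro exI[of _ "\<lambda>n. r (s n)"] exI[of _ "y(i := l)"]) blast
qed

text \<open>Collects what a hyperbolic polynomial and its sigma_(m-1) have in common. The axioms are
  of a kind that can be read off for sigma_(m-1) from its formula in the eigenvalues of g, so
  continuity and closure results serve both.\<close>

locale real_rooted_pencil =
  fixes h :: "real^'n^'n \<Rightarrow> real" and d :: nat and c :: real
  assumes lead_nonzero: "c \<noteq> 0"
    and continuous: "continuous_on Sym2 h"
    and homogeneous: "A \<in> Sym2 \<Longrightarrow> 0 < s \<Longrightarrow> h (s *\<^sub>R A) = s ^ d * h A"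
    and factorization: "A \<in> Sym2 \<Longrightarrow>
          h (t *\<^sub>R mat 1 + A) = c * (\<Prod>j=1..d. t + garding_eigenvalue h j A)"
    and mono: "A \<in> Sym2 \<Longrightarrow> mono_on {1..d} (\<lambda>j. garding_eigenvalue h j A)"
begin

abbreviation "ev \<equiv> garding_eigenvalue h"

section \<open>Shift, scaling and continuity of the ordered eigenvalues\<close>

lemma ev_shift:
  assumes "A \<in> Sym2" and "k \<in> {1..d}"
  shows "ev k (s *\<^sub>R mat 1 + A) = s + ev k A"
proof (rule garding_eigenvalue_eqI[OF _ lead_nonzero _ assms(2)])
  fix t
  show "h (t *\<^sub>R mat 1 + (s *\<^sub>R mat 1 + A)) = c * (\<Prod>j=1..d. t + (s + ev j A))"
    using factorization[OF assms(1), of "t + s"] by (simp add: algebra_simps)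
  show "mono_on {1..d} (\<lambda>j. s + ev j A)"
    using mono[OF assms(1)] by (auto simp: mono_on_def)
qed

lemma ev_scale:
  assumes A: "A \<in> Sym2" and k: "k \<in> {1..d}" and "0 < s"
  shows "ev k (s *\<^sub>R A) = s * ev k A"
proof (rule garding_eigenvalue_eqI[OF _ lead_nonzero _ k])
  fix t
  have "h (t *\<^sub>R mat 1 + s *\<^sub>R A) = h (s *\<^sub>R ((t / s) *\<^sub>R mat 1 + A))"
    using \<open>0 < s\<close> by (simp add: algebra_simps)
  also have "\<dots> = s ^ d * (c * (\<Prod>j=1..d. t / s + ev j A))"
    using \<open>0 < s\<close> A by (simp add: homogeneous factorization Sym2_intros)
  also have "\<dots> = c * (\<Prod>j=1..d. s * (t / s + ev j A))"
    by (simp add: prod.distrib)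
  also have "\<dots> = c * (\<Prod>j=1..d. t + s * ev j A)"
    using \<open>0 < s\<close> by (simp add: algebra_simps)
  finally show "h (t *\<^sub>R mat 1 + s *\<^sub>R A) = c * (\<Prod>j=1..d. t + s * ev j A)" .
  show "mono_on {1..d} (\<lambda>j. s * ev j A)"
    using mono[OF A] \<open>0 < s\<close> by (auto simp: mono_on_def)
qed

lemma ev_scale_shift:
  assumes "A \<in> Sym2" and "k \<in> {1..d}" and "0 < s"
  shows "ev k (s *\<^sub>R (A - e *\<^sub>R mat 1)) = s * (ev k A - e)"
  using ev_shift[OF assms(1,2), of "- e"] ev_scale[of "A - e *\<^sub>R mat 1", OF _ assms(2,3)] assms(1)
  by (simp add: Sym2_intros)

lemma ev_0: "k \<in> {1..d} \<Longrightarrow> ev k 0 = 0"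
  using ev_scale[of 0 k 2] by (simp add: Sym2_0)

text \<open>All eigenvalues of 0 vanish, so the value at s I is c s^d.\<close>

lemma nonzero_scaleR_mat: "s \<noteq> 0 \<Longrightarrow> h (s *\<^sub>R mat 1) \<noteq> 0"
  using factorization[OF Sym2_0, of s] lead_nonzero by (simp add: ev_0)

text \<open>By continuity \<open>h\<close> has no zero near I or -I. An eigenvalue r of A makes -r I
  + A a zero of \<open>h\<close>; divided by |r| this is a zero at distance \<open>norm A\<close> /
  |r| from I or -I, so that quotient is bounded below.\<close>

lemma ev_bounded:
  "\<exists>\<delta>>0. \<forall>A\<in>Sym2. \<forall>k\<in>{1..d}. \<delta> * \<bar>ev k A\<bar> \<le> norm A"
proof -
  have "\<exists>\<delta>>0. \<forall>B\<in>Sym2. dist B (s *\<^sub>R mat 1) < \<delta> \<longrightarrow> h B \<noteq> 0" if "s \<noteq> 0" for s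
  proof -
    have "\<exists>\<delta>>0. \<forall>B\<in>Sym2. dist B (s *\<^sub>R mat 1) < \<delta> \<longrightarrow> dist (h B) (h (s *\<^sub>R mat 1)) < \<bar>h (s *\<^sub>R mat 1)\<bar>"
      using continuous nonzero_scaleR_mat[OF that]
      unfolding continuous_on_iff by (meson Sym2_intros zero_less_abs_iff)
    then show ?thesis by (force simp: dist_real_def)
  qed
  from this[of 1] this[of "- 1"] obtain \<delta>1 \<delta>2 where
    \<delta>: "0 < \<delta>1" "\<And>B. B \<in> Sym2 \<Longrightarrow> dist B (1 *\<^sub>R mat 1) < \<delta>1 \<Longrightarrow> h B \<noteq> 0"
       "0 < \<delta>2" "\<And>B. B \<in> Sym2 \<Longrightarrow> dist B (- 1 *\<^sub>R mat 1) < \<delta>2 \<Longrightarrow> h B \<noteq> 0"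
    by auto
  have "min \<delta>1 \<delta>2 * \<bar>ev k A\<bar> \<le> norm A" if A: "A \<in> Sym2" and k: "k \<in> {1..d}" for A k
  proof (rule ccontr)
    assume "\<not> ?thesis"
    then have *: "norm A < min \<delta>1 \<delta>2 * \<bar>ev k A\<bar>" by simp
    define s where "s = \<bar>ev k A\<bar>"
    have "s \<noteq> 0" using * unfolding s_def by (metis mult_zero_right norm_not_less_zero)
    then have s: "0 < s" by (simp add: s_def)
    define B where "B = (- sgn (ev k A)) *\<^sub>R mat 1 + (1 / s) *\<^sub>R A"
    have "B \<in> Sym2" unfolding B_def by (intro Sym2_intros A)
    have "dist B ((- sgn (ev k A)) *\<^sub>R mat 1) = norm A / s"
      using s by (simp add: B_def dist_norm)
    also have "\<dots> < min \<delta>1 \<delta>2" using *[folded s_def] s by (simp only: pos_divide_less_eq)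
    finally have "h B \<noteq> 0"
      using \<delta>(2)[OF \<open>B \<in> Sym2\<close>] \<delta>(4)[OF \<open>B \<in> Sym2\<close>] s
      by (cases "ev k A > 0") (auto simp: s_def)
    moreover have "s *\<^sub>R B = (- ev k A) *\<^sub>R mat 1 + A"
      using s by (simp add: B_def s_def scaleR_add_right scaleR_diff_right abs_mult_sgn)
    then have "s ^ d * h B = c * (\<Prod>j=1..d. - ev k A + ev j A)"
      using homogeneous[OF \<open>B \<in> Sym2\<close> s] factorization[OF A] by metis
    moreover have "(\<Prod>j=1..d. - ev k A + ev j A) = 0"
      using k by (intro prod_zero) auto
    ultimately have "s ^ d * h B = 0" by (simp only: mult_zero_right)
    with \<open>h B \<noteq> 0\<close> s show False by simp
  qed
  then show ?thesis using \<delta>(1,3) by (intro exI[of _ "min \<delta>1 \<delta>2"]) auto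
qed

text \<open>Along a convergent sequence the eigenvalues are bounded, so on a subsequence all of them
  converge together. Their limits stay ordered and factor \<open>h\<close> on the limiting line,
  hence are the eigenvalues of the limit matrix.\<close>

lemma closed_ev_vimage:
  assumes "closed C" and k: "k \<in> {1..d}"
  shows "closed {A \<in> Sym2. ev k A \<in> C}"
  unfolding closed_sequential_limits
proof (intro allI impI, elim conjE)
  fix f A
  assume f: "\<forall>n. f n \<in> {A \<in> Sym2. ev k A \<in> C}" and lim: "f \<longlonglongrightarrow> A"
  then have fS: "f n \<in> Sym2" for n by simp
  then have A: "A \<in> Sym2"
    using closed_Sym2 lim closed_sequentially by blast
  obtain \<delta> where \<delta>: "\<delta> > 0" "\<And>A k. A \<in> Sym2 \<Longrightarrow> k \<in> {1..d} \<Longrightarrow> \<delta> * \<bar>ev k A\<bar> \<le> norm A"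
    using ev_bounded by blast
  obtain M where M: "\<And>n. norm (f n) \<le> M"
    using convergent_imp_bounded[OF lim] by (auto simp: bounded_iff)
  have "bounded (range (\<lambda>n. ev j (f n)))" if "j \<in> {1..d}" for j
    unfolding bounded_iff
  proof (intro exI[of _ "M / \<delta>"] ballI, elim rangeE)
    fix y n assume "y = ev j (f n)"
    moreover have "\<delta> * \<bar>ev j (f n)\<bar> \<le> M"
      using \<delta>(2)[OF fS that] M order_trans by blast
    ultimately show "norm y \<le> M / \<delta>" using \<delta>(1) by (simp add: field_simps)
  qed
  then obtain r y where r: "strict_mono r"
    and y: "\<And>j. j \<in> {1..d} \<Longrightarrow> (\<lambda>n. ev j (f (r n))) \<longlonglongrightarrow> y j"
    using bounded_family_convergent_subsequence[of "{1..d}" "\<lambda>j n. ev j (f n)"] by blast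
  have lim_r: "(\<lambda>n. f (r n)) \<longlonglongrightarrow> A"
    using LIMSEQ_subseq_LIMSEQ[OF lim r] by (simp add: comp_def)
  have "ev k A = y k"
  proof (rule garding_eigenvalue_eqI[OF _ lead_nonzero _ k])
    fix t
    have "(\<lambda>n. h (t *\<^sub>R mat 1 + f (r n))) \<longlonglongrightarrow> h (t *\<^sub>R mat 1 + A)"
      by (rule continuous_on_tendsto_compose[OF continuous])
        (simp_all add: Sym2_intros fS A tendsto_add lim_r)
    moreover have "(\<lambda>n. h (t *\<^sub>R mat 1 + f (r n))) \<longlonglongrightarrow> c * (\<Prod>j=1..d. t + y j)"
      unfolding factorization[OF fS] by (intro tendsto_intros y)
    ultimately show "h (t *\<^sub>R mat 1 + A) = c * (\<Prod>j=1..d. t + y j)"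
      by (rule LIMSEQ_unique)
    show "mono_on {1..d} y"
    proof (rule mono_onI)
      fix i j assume "i \<in> {1..d}" "j \<in> {1..d}" "i \<le> j"
      then show "y i \<le> y j"
        using mono[OF fS] by (intro LIMSEQ_le[OF y y]) (auto simp: mono_on_def)
    qed
  qed
  moreover have "y k \<in> C"
    using closed_sequentially[OF \<open>closed C\<close> _ y[OF k]] f by simp
  ultimately show "A \<in> {A \<in> Sym2. ev k A \<in> C}" using A by simp
qed

lemma continuous_on_ev:
  assumes "k \<in> {1..d}"
  shows "continuous_on Sym2 (ev k)"
proof (rule continuous_on_closed_vimage[OF closed_Sym2, THEN iffD2], intro allI impI)
  fix C :: "real set" assume "closed C"
  moreover have "ev k -` C \<inter> Sym2 = {A \<in> Sym2. ev k A \<in> C}" by auto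
  ultimately show "closed (ev k -` C \<inter> Sym2)" using closed_ev_vimage[OF _ assms] by simp
qed

text \<open>Adding a small positive multiple of I raises every eigenvalue by that amount, so each
  point of the branch is a limit of points with positive k-th eigenvalue.\<close>

lemma closure_ev_pos:
  assumes k: "k \<in> {1..d}"
  shows "closure {A \<in> Sym2. 0 < ev k A} = garding_branch h k"
proof
  have "closed (garding_branch h k)"
    using closed_ev_vimage[of "{0..}" k] k by (simp add: garding_branch_def)
  then show "closure {A \<in> Sym2. 0 < ev k A} \<subseteq> garding_branch h k"
    by (intro closure_minimal) (auto simp: garding_branch_def)
  show "garding_branch h k \<subseteq> closure {A \<in> Sym2. 0 < ev k A}"
  proof
    fix A assume "A \<in> garding_branch h k"
    then have A: "A \<in> Sym2" "0 \<le> ev k A" by (auto simp: garding_branch_def)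
    have "(\<lambda>n. (1 / real (Suc n)) *\<^sub>R mat 1 + A) \<longlonglongrightarrow> 0 *\<^sub>R mat 1 + A"
      by (intro tendsto_intros LIMSEQ_Suc lim_1_over_n)
    moreover have "(1 / real (Suc n)) *\<^sub>R mat 1 + A \<in> {A \<in> Sym2. 0 < ev k A}" for n
      using A ev_shift[OF A(1) k, of "1 / real (Suc n)"]
      by (simp add: Sym2_intros add_pos_nonneg)
    ultimately show "A \<in> closure {A \<in> Sym2. 0 < ev k A}"
      unfolding closure_sequential by fastforce
  qed
qed

end

section \<open>Asymptotics of arctangent sums\<close>

context real_rooted_pencil
begin

lemma arctan_set_scale_shift:
  assumes "A \<in> Sym2" and "0 < t"
  shows "t *\<^sub>R (A - e *\<^sub>R mat 1) \<in> arctan_set d h \<theta> \<longleftrightarrow>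
    \<theta> \<le> (\<Sum>j=1..d. arctan (t * (ev j A - e)))"
proof -
  have "(\<Sum>j=1..d. arctan (ev j (t *\<^sub>R (A - e *\<^sub>R mat 1)))) = (\<Sum>j=1..d. arctan (t * (ev j A - e)))"
    using assms by (intro sum.cong) (simp_all only: ev_scale_shift)
  then show ?thesis using assms by (simp add: arctan_set_def Sym2_intros)
qed

text \<open>Reduces the asymptotic interior to a condition on the numbers \<open>ev j A\<close>
  alone, so that the analysis below deals only with finite families of reals.\<close>

lemma asymptotic_interior_arctan_set:
  "asymptotic_interior (arctan_set d h \<theta>) =
    {A \<in> Sym2. \<exists>e>0. \<forall>\<^sub>F t in at_top. \<theta> \<le> (\<Sum>j=1..d. arctan (t * (ev j A - e)))}"
proof -
  have "(\<exists>t0. \<forall>t\<ge>t0. t *\<^sub>R (A - e *\<^sub>R mat 1) \<in> arctan_set d h \<theta>) \<longleftrightarrow>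
    (\<forall>\<^sub>F t in at_top. \<theta> \<le> (\<Sum>j=1..d. arctan (t * (ev j A - e))))" if A: "A \<in> Sym2" for A e
  proof -
    have "(\<exists>t0. \<forall>t\<ge>t0. t *\<^sub>R (A - e *\<^sub>R mat 1) \<in> arctan_set d h \<theta>) \<longleftrightarrow>
      (\<forall>\<^sub>F t in at_top. t *\<^sub>R (A - e *\<^sub>R mat 1) \<in> arctan_set d h \<theta>)"
      by (simp add: eventually_at_top_linorder)
    also have "\<dots> \<longleftrightarrow> (\<forall>\<^sub>F t in at_top. \<theta> \<le> (\<Sum>j=1..d. arctan (t * (ev j A - e))))"
      by (rule eventually_cong[OF eventually_gt_at_top[of 0]])
        (rule arctan_set_scale_shift[OF A])
    finally show ?thesis .
  qed
  then show ?thesis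
    unfolding asymptotic_interior_def by (intro Collect_cong conj_cong refl) (simp only:)
qed

end

lemma tendsto_sum_arctan:
  fixes x :: "nat \<Rightarrow> real"
  shows "((\<lambda>t. \<Sum>j\<in>I. arctan (t * x j)) \<longlongrightarrow> (\<Sum>j\<in>I. sgn (x j)) * (pi / 2)) at_top"
proof -
  have "((\<lambda>t. arctan (t * y)) \<longlongrightarrow> sgn y * (pi / 2)) at_top" for y :: real
  proof (cases y "0::real" rule: linorder_cases)
    case less
    then show ?thesis by real_asymp
  next
    case greater
    then show ?thesis by real_asymp
  qed simp
  then show ?thesis unfolding sum_distrib_right by (intro tendsto_sum)
qed

text \<open>For s nonzero, arctan s = sgn s pi/2 - arctan (1/s), and arctan u is asymptotic to u at
  0; with s = t y the remainder is asymptotic to -1/(t y).\<close>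

lemma tendsto_sum_arctan_remainder:
  fixes x :: "nat \<Rightarrow> real"
  assumes "\<And>j. j \<in> I \<Longrightarrow> x j \<noteq> 0"
  shows "((\<lambda>t. t * ((\<Sum>j\<in>I. arctan (t * x j)) - (\<Sum>j\<in>I. sgn (x j)) * (pi / 2)))
    \<longlongrightarrow> - (\<Sum>j\<in>I. 1 / x j)) at_top"
proof -
  have "((\<lambda>t. t * (arctan (t * y) - sgn y * (pi / 2))) \<longlongrightarrow> - (1 / y)) at_top"
    if "y \<noteq> 0" for y :: real
  proof (cases "0 < y")
    case True
    then show ?thesis by (simp flip: inverse_eq_divide) real_asymp
  next
    case False
    with that have "y < 0" by simp
    then show ?thesis by (simp flip: inverse_eq_divide) real_asymp
  qed
  then show ?thesis
    unfolding sum_distrib_right sum_distrib_left sum_subtractf[symmetric] sum_negf[symmetric]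
    using assms by (intro tendsto_sum) blast
qed

text \<open>The m - k + 1 entries from index k on contribute 1 each, the k - 1 earlier ones at least
  -1 each.\<close>

lemma sum_sgn_ge:
  fixes x :: "nat \<Rightarrow> real"
  assumes mono: "mono_on {1..m} x" and k: "k \<in> {1..m}" and "0 < x k"
  shows "real m - 2 * (real k - 1) \<le> (\<Sum>j=1..m. sgn (x j))"
proof -
  have "(\<Sum>j=1..m. sgn (x j)) = (\<Sum>j=1..<k. sgn (x j)) + (\<Sum>j=k..<Suc m. sgn (x j))"
    using k by (subst sum.atLeastLessThan_concat) (auto simp: atLeastLessThanSuc_atLeastAtMost)
  moreover have "(\<Sum>j=1..<k. - 1) \<le> (\<Sum>j=1..<k. sgn (x j))"
    by (intro sum_mono) (simp add: sgn_if)
  moreover have "(\<Sum>j=k..<Suc m. 1) = (\<Sum>j=k..<Suc m. sgn (x j))"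
  proof (rule sum.cong[OF refl])
    fix j assume "j \<in> {k..<Suc m}"
    then have "x k \<le> x j" using mono k by (auto simp: mono_on_def)
    with \<open>0 < x k\<close> show "1 = sgn (x j)" by simp
  qed
  ultimately show ?thesis using k by (simp add: of_nat_diff)
qed

text \<open>The first k entries contribute -1 each, the remaining m - k at most 1 each.\<close>

lemma sum_sgn_le:
  fixes x :: "nat \<Rightarrow> real"
  assumes mono: "mono_on {1..m} x" and k: "k \<in> {1..m}" and "x k < 0"
  shows "(\<Sum>j=1..m. sgn (x j)) \<le> real m - 2 * real k"
proof -
  have "(\<Sum>j=1..m. sgn (x j)) = (\<Sum>j=1..<Suc k. sgn (x j)) + (\<Sum>j=Suc k..<Suc m. sgn (x j))"
    using k by (subst sum.atLeastLessThan_concat) (auto simp: atLeastLessThanSuc_atLeastAtMost)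
  moreover have "(\<Sum>j=Suc k..<Suc m. sgn (x j)) \<le> (\<Sum>j=Suc k..<Suc m. 1)"
    by (intro sum_mono) (simp add: sgn_if)
  moreover have "(\<Sum>j=1..<Suc k. - 1) = (\<Sum>j=1..<Suc k. sgn (x j))"
  proof (rule sum.cong[OF refl])
    fix j assume "j \<in> {1..<Suc k}"
    then have "x j \<le> x k" using mono k by (auto simp: mono_on_def)
    with \<open>x k < 0\<close> show "- 1 = sgn (x j)" by simp
  qed
  ultimately show ?thesis using k by (simp add: of_nat_diff)
qed

text \<open>In units of pi/2 the limit is at least m - 2(k - 1) when \<open>x k - e\<close> is
  positive and at most m - 2k when it is negative; \<open>\<theta>\<close> lies strictly between
  these values.\<close>

lemma eventually_sum_arctan_iff_nondegenerate:
  fixes x :: "nat \<Rightarrow> real"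
  assumes mono: "mono_on {1..m} x" and k: "k \<in> {1..m}"
    and \<theta>: "\<theta> \<in> {(real m - 2 * real k) * (pi / 2) <..< (real m - 2 * (real k - 1)) * (pi / 2)}"
  shows "(\<exists>e>0. \<forall>\<^sub>F t in at_top. \<theta> \<le> (\<Sum>j=1..m. arctan (t * (x j - e)))) \<longleftrightarrow> 0 < x k"
proof -
  note \<theta>' = \<theta>[unfolded greaterThanLessThan_iff]
  show ?thesis
  proof
    assume "0 < x k"
    define e where "e = x k / 2"
    have e: "0 < e" "0 < x k - e" using \<open>0 < x k\<close> by (simp_all add: e_def)
    have "mono_on {1..m} (\<lambda>j. x j - e)" using mono by (auto simp: mono_on_def)
    from sum_sgn_ge[OF this k e(2)]
    have "(real m - 2 * (real k - 1)) * (pi / 2) \<le> (\<Sum>j=1..m. sgn (x j - e)) * (pi / 2)"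
      by (intro mult_right_mono) auto
    with \<theta>' have "\<theta> < (\<Sum>j=1..m. sgn (x j - e)) * (pi / 2)" by linarith
    from order_tendstoD(1)[OF tendsto_sum_arctan this]
    have "\<forall>\<^sub>F t in at_top. \<theta> \<le> (\<Sum>j=1..m. arctan (t * (x j - e)))"
      by (rule eventually_mono) (rule less_imp_le)
    with e(1) show "\<exists>e>0. \<forall>\<^sub>F t in at_top. \<theta> \<le> (\<Sum>j=1..m. arctan (t * (x j - e)))"
      by blast
  next
    assume "\<exists>e>0. \<forall>\<^sub>F t in at_top. \<theta> \<le> (\<Sum>j=1..m. arctan (t * (x j - e)))"
    then obtain e where e: "0 < e" "\<forall>\<^sub>F t in at_top. \<theta> \<le> (\<Sum>j=1..m. arctan (t * (x j - e)))"
      by blast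
    have "\<theta> \<le> (\<Sum>j=1..m. sgn (x j - e)) * (pi / 2)"
      by (rule tendsto_lowerbound[OF tendsto_sum_arctan e(2)]) simp
    moreover have mono': "mono_on {1..m} (\<lambda>j. x j - e)"
      using mono by (auto simp: mono_on_def)
    have "(\<Sum>j=1..m. sgn (x j - e)) * (pi / 2) \<le> (real m - 2 * real k) * (pi / 2)"
      if "x k - e < 0"
      using sum_sgn_le[OF mono' k that] by (intro mult_right_mono) auto
    \<comment> \<open>Only the weak bound \<open>e \<le> x k\<close> results; positivity of
      \<open>e\<close> makes the conclusion strict.\<close>
    ultimately have "\<not> x k - e < 0"
      using \<theta>' by linarith
    with e(1) show "0 < x k" by simp
  qed
qed

text \<open>At the critical phases the limit of the arctangent sum is the phase itself, so the first-order
  term \<open>- (\<Sum>j. 1 / (x j - e)) / t\<close> decides.\<close>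

lemma eventually_sum_arctan_iff_critical:
  fixes x y :: "nat \<Rightarrow> real"
  assumes mono: "mono_on {1..m} x" and k: "k \<in> {1..m - 1}"
    and interlace: "y k \<le> x (Suc k)" "x k \<le> y k"
    and sign: "\<And>e. x k < e \<Longrightarrow> e < x (Suc k) \<Longrightarrow> sgn (\<Sum>j=1..m. 1 / (x j - e)) = - sgn (y k - e)"
  shows "(\<exists>e>0. \<forall>\<^sub>F t in at_top. (real m - 2 * real k) * (pi / 2) \<le> (\<Sum>j=1..m. arctan (t * (x j - e))))
    \<longleftrightarrow> 0 < y k" (is "(\<exists>e>0. ?P e) \<longleftrightarrow> _")
proof -
  let ?\<theta> = "(real m - 2 * real k) * (pi / 2)"
  let ?S = "\<lambda>e. \<Sum>j=1..m. sgn (x j - e)"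
  \<comment> \<open>The first-order term has poles at the \<open>x j\<close>, so \<open>e\<close>
    must avoid these finitely many values.\<close>
  have generic: "\<exists>e'>0. e' < e \<and> (\<forall>j\<in>{1..m}. x j \<noteq> e')" if "0 < e" for e
  proof -
    have "infinite ({0<..<e} - x ` {1..m})"
      using that by (intro Diff_infinite_finite) auto
    then have "{0<..<e} - x ` {1..m} \<noteq> {}" by (metis finite.emptyI)
    then show ?thesis by fastforce
  qed
  have k': "k \<in> {1..m}" "Suc k \<in> {1..m}" using k by auto
  have mono': "mono_on {1..m} (\<lambda>j. x j - e)" for e using mono by (auto simp: mono_on_def)
  have S: "?S e = real m - 2 * real k" if "x k < e" "e < x (Suc k)" for e
  proof (rule antisym)
    show "?S e \<le> real m - 2 * real k"
      using sum_sgn_le[OF mono' k'(1)] that(1) by simp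
    show "real m - 2 * real k \<le> ?S e"
      using sum_sgn_ge[OF mono' k'(2), of e] that(2) by simp
  qed
  have rem: "((\<lambda>t. t * ((\<Sum>j=1..m. arctan (t * (x j - e))) - ?\<theta>)) \<longlongrightarrow> - (\<Sum>j=1..m. 1 / (x j - e))) at_top"
    if "x k < e" "e < x (Suc k)" "\<forall>j\<in>{1..m}. x j \<noteq> e" for e
    using tendsto_sum_arctan_remainder[of "{1..m}" "\<lambda>j. x j - e"] that(3) S[OF that(1,2)] by simp
  show ?thesis
  proof
    assume "0 < y k"
    then obtain e where e: "0 < e" "e < y k" "\<forall>j\<in>{1..m}. x j \<noteq> e" using generic by metis
    show "\<exists>e>0. ?P e"
    proof (intro exI conjI)
      show "0 < e" by fact
      show "?P e"
      \<comment> \<open>If \<open>e < x k\<close>, at least m - k + 1 differences are positive and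
        the limit already exceeds the phase. Otherwise the limit equals the phase and the
        first-order term must be positive.\<close>
      proof (cases "e < x k")
        case True
        then have "real m - 2 * real k < ?S e"
          using sum_sgn_ge[OF mono' k'(1), of e] by simp
        then have "?\<theta> < ?S e * (pi / 2)"
          by (intro mult_strict_right_mono) auto
        from order_tendstoD(1)[OF tendsto_sum_arctan this]
        show ?thesis by (rule eventually_mono) (rule less_imp_le)
      next
        case False
        with e(3) k'(1) have "x k < e" by (metis linorder_neqE)
        moreover have "e < x (Suc k)" using e(2) interlace(1) by linarith
        ultimately have xe: "x k < e" "e < x (Suc k)" .
        then have "0 < - (\<Sum>j=1..m. 1 / (x j - e))"
          using sign[OF xe] e(2) by (simp add: sgn_if split: if_splits)
        from order_tendstoD(1)[OF rem[OF xe e(3)] this] eventually_gt_at_top[of 0]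
        show ?thesis by eventually_elim (simp add: zero_less_mult_iff)
      qed
    qed
  next
    assume "\<exists>e>0. ?P e"
    then obtain e0 where e0: "0 < e0" "?P e0" by blast
    then obtain e where e: "0 < e" "e < e0" "\<forall>j\<in>{1..m}. x j \<noteq> e" using generic by metis
    \<comment> \<open>Lowering \<open>e0\<close> to the generic value \<open>e\<close> raises each
      arctangent, so the inequality persists.\<close>
    have "?P e"
      using e0(2) eventually_gt_at_top[of 0]
    proof eventually_elim
      case (elim t)
      have "(\<Sum>j=1..m. arctan (t * (x j - e0))) \<le> (\<Sum>j=1..m. arctan (t * (x j - e)))"
        using elim(2) e(2) by (intro sum_mono) (simp add: arctan_le_iff)
      with elim(1) show ?case by linarith
    qed
    have "?\<theta> \<le> ?S e * (pi / 2)"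
      by (rule tendsto_lowerbound[OF tendsto_sum_arctan \<open>?P e\<close>]) simp
    then have "real m - 2 * real k \<le> ?S e" by simp
    \<comment> \<open>Otherwise k + 1 negative differences would push the sign sum down to m - 2(k +
      1).\<close>
    then have "\<not> x (Suc k) < e"
      using sum_sgn_le[OF mono' k'(2), of e] by auto
    with e(3) k' have x_Suc: "e < x (Suc k)" by (metis linorder_neqE)
    show "0 < y k"
    proof (cases "e < x k")
      case True
      then show ?thesis using e(1) interlace(2) by simp
    next
      case False
      with e(3) k' have xk: "x k < e" by (metis linorder_neqE)
      have "\<forall>\<^sub>F t in at_top. 0 \<le> t * ((\<Sum>j=1..m. arctan (t * (x j - e))) - ?\<theta>)"
        using \<open>?P e\<close> eventually_gt_at_top[of 0] by eventually_elim simp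
      from tendsto_lowerbound[OF rem[OF xk x_Suc e(3)] this]
      have "0 \<le> - (\<Sum>j=1..m. 1 / (x j - e))" by simp
      with sign[OF xk x_Suc] have "e \<le> y k" by (auto simp: sgn_if split: if_splits)
      with e(1) show ?thesis by simp
    qed
  qed
qed

section \<open>Hyperbolic polynomials and their derivatives\<close>

text \<open>Dividing by a higher power of t turns a finite limit into 0. So two different exponents
  cannot both give finite nonzero limits, and the true degree gives one.\<close>

lemma degree_lead_coeff_eqI:
  fixes p :: "real poly"
  assumes lim: "((\<lambda>t. poly p t / t ^ m) \<longlongrightarrow> l) at_top" and "l \<noteq> 0"
  shows "degree p = m" and "lead_coeff p = l"
proof -
  let ?n = "degree p"
  have lim_p: "((\<lambda>t. poly p t / t ^ ?n) \<longlongrightarrow> lead_coeff p) at_top"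
    using poly_divide_tendsto_aux[of p] at_top_le_at_infinity by (rule tendsto_mono[rotated])
  have decay: "((\<lambda>t. u t / t ^ (b - a)) \<longlongrightarrow> 0) at_top"
    if "(u \<longlongrightarrow> v) at_top" "a < b" for u :: "real \<Rightarrow> real" and v and a b :: nat
    by (rule real_tendsto_divide_at_top[OF that(1) filterlim_pow_at_top[OF _ filterlim_ident]])
      (use that(2) in simp)
  have cancel: "\<forall>\<^sub>F t in at_top. poly p t / t ^ a / t ^ (b - a) = poly p t / t ^ b"
    if "a < b" for a b
    using eventually_gt_at_top[of 0]
    by eventually_elim (use that in \<open>simp flip: power_add\<close>)
  have "\<not> ?n < m"
    using tendsto_unique[OF _ lim tendsto_cong[THEN iffD1, OF cancel decay[OF lim_p]]] \<open>l \<noteq> 0\<close>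
    by auto
  moreover have "\<not> m < ?n"
  proof
    assume "m < ?n"
    then have "lead_coeff p = 0"
      using tendsto_unique[OF _ lim_p tendsto_cong[THEN iffD1, OF cancel decay[OF lim]]] by auto
    with \<open>m < ?n\<close> show False by auto
  qed
  ultimately show "?n = m" by simp
  then show "lead_coeff p = l"
    using tendsto_unique[OF _ lim_p] lim by simp
qed

text \<open>By homogeneity g(tI + A) / t^m = g(I + A/t), which tends to g(I). Hence every line
  polynomial has full degree m and leading coefficient g(I), and real-rootedness yields exactly m
  eigenvalues.\<close>

lemma real_rooted_pencil_garding_hyperbolic:
  fixes g :: "real^'n^'n \<Rightarrow> real"
  assumes "garding_hyperbolic m g"
  shows "real_rooted_pencil g m (g (mat 1))"
proof -
  have hom: "homogeneous_polynomial m g" and nz: "g (mat 1) \<noteq> 0"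
    and real: "\<And>A z. A \<in> Sym2 \<Longrightarrow> poly (map_poly complex_of_real (line_poly g A)) z = 0 \<Longrightarrow> z \<in> \<real>"
    using assms by (auto simp: garding_hyperbolic_def)
  obtain q where q: "real_polynomial_function q" "\<And>A. A \<in> Sym2 \<Longrightarrow> g A = q A"
    using hom unfolding homogeneous_polynomial_def by blast
  have scale: "g (t *\<^sub>R A) = t ^ m * g A" if "A \<in> Sym2" for A t
    using hom that unfolding homogeneous_polynomial_def by blast
  have "continuous_on Sym2 q"
    using continuous_real_polymonial_function[OF q(1)] by (simp add: continuous_at_imp_continuous_on)
  then have cont: "continuous_on Sym2 g"
    using q(2) by (simp cong: continuous_on_cong)
  have line: "degree (line_poly g A) = m" "lead_coeff (line_poly g A) = g (mat 1)"
    "size (proots (line_poly g A)) = m" if A: "A \<in> Sym2" for A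
  proof -
    have "((\<lambda>t. g (mat 1 + (1 / t) *\<^sub>R A)) \<longlongrightarrow> g (mat 1)) at_top"
    proof (rule continuous_on_tendsto_compose[OF cont])
      have "((\<lambda>t. mat 1 + (1 / t) *\<^sub>R A) \<longlongrightarrow> mat 1 + 0 *\<^sub>R A) at_top"
        by (intro tendsto_intros tendsto_divide_0[OF tendsto_const] filterlim_at_top_imp_at_infinity
            filterlim_ident)
      then show "((\<lambda>t. mat 1 + (1 / t) *\<^sub>R A) \<longlongrightarrow> mat 1) at_top" by simp
    qed (simp_all add: Sym2_intros A)
    moreover have "\<forall>\<^sub>F t in at_top. g (mat 1 + (1 / t) *\<^sub>R A) = poly (line_poly g A) t / t ^ m"
      using eventually_gt_at_top[of 0]
    proof eventually_elim
      case (elim t)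
      have "poly (line_poly g A) t = g (t *\<^sub>R (mat 1 + (1 / t) *\<^sub>R A))"
        using elim by (simp add: poly_line_poly[OF hom A] scaleR_add_right)
      also have "\<dots> = t ^ m * g (mat 1 + (1 / t) *\<^sub>R A)"
        by (intro scale Sym2_intros A)
      finally show ?case using elim by simp
    qed
    ultimately have lim: "((\<lambda>t. poly (line_poly g A) t / t ^ m) \<longlongrightarrow> g (mat 1)) at_top"
      by (rule Lim_transform_eventually)
    show deg: "degree (line_poly g A) = m" and lc: "lead_coeff (line_poly g A) = g (mat 1)"
      using degree_lead_coeff_eqI[OF lim nz] .
    have "line_poly g A \<noteq> 0" using lc nz by auto
    then show "size (proots (line_poly g A)) = m"
      using size_proots_if_complex_roots_real real[OF A] deg by metis
  qed
  show ?thesis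
  proof
    fix A :: "real^'n^'n" assume A: "A \<in> Sym2"
    show "g (t *\<^sub>R mat 1 + A) = g (mat 1) * (\<Prod>j=1..m. t + garding_eigenvalue g j A)" for t
      using garding_eigenvalue_factorization[of g A "line_poly g A"] poly_line_poly[OF hom A] line[OF A]
      by simp
    show "mono_on {1..m} (\<lambda>j. garding_eigenvalue g j A)"
      using mono_garding_eigenvalue[of g A "line_poly g A"] poly_line_poly[OF hom A] line[OF A]
      by simp
  qed (use nz cont scale in auto)
qed

section \<open>Interlacing of the roots of a polynomial and of its derivative\<close>

lemma proots_prod_linear:
  fixes x :: "'i \<Rightarrow> 'a::idom"
  shows "proots (\<Prod>j\<in>I. [:x j, 1:]) = image_mset (\<lambda>j. - x j) (mset_set I)"
  by (cases "finite I") (simp_all add: proots_prod sum_unfold_sum_mset)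

lemma monic_prod_linear:
  fixes x :: "'i \<Rightarrow> 'a::idom"
  shows "degree (\<Prod>j\<in>I. [:x j, 1:]) = card I" and "lead_coeff (\<Prod>j\<in>I. [:x j, 1:]) = 1"
  unfolding lead_coeff_prod by (simp_all add: degree_prod_eq_sum_degree)

lemma sgn_prod:
  fixes f :: "'i \<Rightarrow> 'a::linordered_idom"
  shows "sgn (\<Prod>i\<in>I. f i) = (\<Prod>i\<in>I. sgn (f i))"
  by (induction I rule: infinite_finite_induct) (simp_all add: sgn_mult)

text \<open>The one-variable situation on a single line tI + A: the roots are \<open>- x j\<close>
  and \<open>- y j\<close>, so increasing \<open>x\<close> and \<open>y\<close> list roots in
  decreasing order.\<close>

locale derivative_roots =
  fixes d :: nat and x y :: "nat \<Rightarrow> real" and c :: real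
  assumes mono_x: "mono_on {1..d} x" and mono_y: "mono_on {1..d - 1} y" and c_pos: "0 < c"
    and pderiv_eq: "pderiv (\<Prod>j=1..d. [:x j, 1:]) = smult c (\<Prod>j=1..d - 1. [:y j, 1:])"
begin

lemma card_roots_interval:
  assumes "is_interval S"
  shows "card {j \<in> {1..d}. - x j \<in> S} \<le> Suc (card {j \<in> {1..d - 1}. - y j \<in> S})"
proof -
  have count: "size (filter_mset (\<lambda>t. t \<in> S) (image_mset (\<lambda>j. - z j) (mset_set I))) =
      card {j \<in> I. - z j \<in> S}" if "finite I" for z :: "nat \<Rightarrow> real" and I
    using that by (simp add: filter_mset_image_mset)
  have "c \<noteq> 0" using c_pos by simp
  then have "pderiv (\<Prod>j=1..d. [:x j, 1:]) \<noteq> 0"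
    unfolding pderiv_eq by simp
  from size_roots_pderiv_ge[OF this assms] show ?thesis
    unfolding pderiv_eq proots_smult[OF \<open>c \<noteq> 0\<close>] proots_prod_linear
    by (simp only: count finite_atLeastAtMost)
qed

text \<open>If \<open>y k < x k\<close>, the polynomial has at least d - k + 1 roots in the
  half-line up to \<open>- x k\<close>, its derivative at most d - 1 - k. That is a loss of two, but
  \<open>card_roots_interval\<close> permits one. The second bound is the mirror image, with k + 1
  against k - 1 roots.\<close>

lemma interlace:
  assumes k: "k \<in> {1..d - 1}"
  shows "x k \<le> y k" and "y k \<le> x (Suc k)"
proof -
  have k': "k \<in> {1..d}" "Suc k \<in> {1..d}" using k by auto
  show "x k \<le> y k"
  proof (rule ccontr)
    assume less: "\<not> x k \<le> y k"
    have "{k..d} \<subseteq> {j \<in> {1..d}. - x j \<in> {..- x k}}"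
      using mono_onD[OF mono_x k'(1)] k by auto
    then have "card {k..d} \<le> card {j \<in> {1..d}. - x j \<in> {..- x k}}"
      by (intro card_mono) auto
    also have "\<dots> \<le> Suc (card {j \<in> {1..d - 1}. - y j \<in> {..- x k}})"
      by (intro card_roots_interval is_interval_ic)
    also have "{j \<in> {1..d - 1}. - y j \<in> {..- x k}} \<subseteq> {Suc k..d - 1}"
    proof
      fix j assume j: "j \<in> {j \<in> {1..d - 1}. - y j \<in> {..- x k}}"
      then have "\<not> j \<le> k"
        using mono_onD[OF mono_y, of j k] k less by auto
      with j show "j \<in> {Suc k..d - 1}" by auto
    qed
    then have "card {j \<in> {1..d - 1}. - y j \<in> {..- x k}} \<le> card {Suc k..d - 1}"
      by (intro card_mono) auto
    finally show False using k by auto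
  qed
  show "y k \<le> x (Suc k)"
  proof (rule ccontr)
    assume less: "\<not> y k \<le> x (Suc k)"
    have "{1..Suc k} \<subseteq> {j \<in> {1..d}. - x j \<in> {- x (Suc k)..}}"
      using mono_onD[OF mono_x _ k'(2)] k' by auto
    then have "card {1..Suc k} \<le> card {j \<in> {1..d}. - x j \<in> {- x (Suc k)..}}"
      by (intro card_mono) auto
    also have "\<dots> \<le> Suc (card {j \<in> {1..d - 1}. - y j \<in> {- x (Suc k)..}})"
      by (intro card_roots_interval is_interval_ci)
    also have "{j \<in> {1..d - 1}. - y j \<in> {- x (Suc k)..}} \<subseteq> {1..<k}"
    proof
      fix j assume j: "j \<in> {j \<in> {1..d - 1}. - y j \<in> {- x (Suc k)..}}"
      then have "\<not> k \<le> j"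
        using mono_onD[OF mono_y, of k j] k less by auto
      with j show "j \<in> {1..<k}" by auto
    qed
    then have "card {j \<in> {1..d - 1}. - y j \<in> {- x (Suc k)..}} \<le> card {1..<k}"
      by (intro card_mono) auto
    finally show False using k by auto
  qed
qed

text \<open>The sum is the logarithmic derivative P'/P at -e of P(t) = prod (t + x_j). Exactly k
  factors of P(-e) are negative. By interlacing the first k - 1 factors of P'(-e) are negative and
  those after the k-th positive, so the quotient has the sign opposite to
  \<open>y k - e\<close>.\<close>

lemma sgn_sum_inverse:
  assumes k: "k \<in> {1..d - 1}" and e: "x k < e" "e < x (Suc k)"
  shows "sgn (\<Sum>j=1..d. 1 / (x j - e)) = - sgn (y k - e)"
proof -
  have k': "k \<in> {1..d}" "Suc k \<in> {1..d}" using k by auto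
  have x_neg: "x j < e" if "j \<in> {1..<Suc k}" for j
    using mono_onD[OF mono_x _ k'(1), of j] that k' e(1) by auto
  have x_pos: "e < x j" if "j \<in> {Suc k..<Suc d}" for j
    using mono_onD[OF mono_x k'(2), of j] that e(2) by auto
  have nz: "x j - e \<noteq> 0" if "j \<in> {1..d}" for j
    using x_neg[of j] x_pos[of j] that by (cases "j \<le> k") auto
  have "1 / (x i - e) = (\<Prod>j\<in>{1..d} - {i}. x j - e) / (\<Prod>j=1..d. x j - e)" if "i \<in> {1..d}" for i
  proof -
    have "(\<Prod>j\<in>{1..d} - {i}. x j - e) \<noteq> 0"
      using nz by (subst prod_zero_iff) blast+
    then show ?thesis
      unfolding prod.remove[OF finite_atLeastAtMost that] by simp
  qed
  then have "(\<Sum>j=1..d. 1 / (x j - e)) = (\<Sum>i=1..d. \<Prod>j\<in>{1..d} - {i}. x j - e) / (\<Prod>j=1..d. x j - e)"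
    unfolding sum_divide_distrib by (rule sum.cong[OF refl])
  also have "(\<Sum>i=1..d. \<Prod>j\<in>{1..d} - {i}. x j - e) = poly (pderiv (\<Prod>j=1..d. [:x j, 1:])) (- e)"
    by (simp add: pderiv_prod pderiv_pCons poly_sum poly_prod)
  also have "\<dots> = c * (\<Prod>j=1..d - 1. y j - e)"
    unfolding pderiv_eq by (simp add: poly_prod)
  finally have "sgn (\<Sum>j=1..d. 1 / (x j - e)) =
      (\<Prod>j=1..d - 1. sgn (y j - e)) / (\<Prod>j=1..d. sgn (x j - e))"
    using c_pos by (simp add: sgn_divide sgn_mult sgn_prod)
  moreover have "(\<Prod>j=1..d. sgn (x j - e)) = (- 1) ^ k"
  proof -
    have "(\<Prod>j=1..d. sgn (x j - e)) =
        (\<Prod>j=1..<Suc k. sgn (x j - e)) * (\<Prod>j=Suc k..<Suc d. sgn (x j - e))"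
      using k by (subst prod.atLeastLessThan_concat) (auto simp: atLeastLessThanSuc_atLeastAtMost)
    also have "(\<Prod>j=1..<Suc k. sgn (x j - e)) = (\<Prod>j=1..<Suc k. - 1)"
      using x_neg by (intro prod.cong refl) simp
    also have "(\<Prod>j=Suc k..<Suc d. sgn (x j - e)) = (\<Prod>j=Suc k..<Suc d. 1)"
      using x_pos by (intro prod.cong refl) simp
    finally show ?thesis by simp
  qed
  moreover have "(\<Prod>j=1..d - 1. sgn (y j - e)) = (- 1) ^ (k - 1) * sgn (y k - e)"
  proof -
    have "{1..d - 1} = {1..<d}" by auto
    then have "(\<Prod>j=1..d - 1. sgn (y j - e)) =
        (\<Prod>j=1..<k. sgn (y j - e)) * (\<Prod>j=k..<d. sgn (y j - e))"
      using k by (subst prod.atLeastLessThan_concat) auto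
    also have "(\<Prod>j=k..<d. sgn (y j - e)) = sgn (y k - e) * (\<Prod>j=Suc k..<d. sgn (y j - e))"
      using k by (intro prod.atLeast_Suc_lessThan) auto
    also have "(\<Prod>j=Suc k..<d. sgn (y j - e)) = (\<Prod>j=Suc k..<d. 1)"
    proof (intro prod.cong refl)
      fix j assume "j \<in> {Suc k..<d}"
      then have "j \<in> {1..d - 1}" "j \<in> {Suc k..<Suc d}" by auto
      \<comment> \<open>For j > k, \<open>y j\<close> is at least \<open>x j\<close>, which exceeds
        \<open>e\<close>.\<close>
      then show "sgn (y j - e) = 1" using interlace(1)[of j] x_pos[of j] by simp
    qed
    also have "(\<Prod>j=1..<k. sgn (y j - e)) = (\<Prod>j=1..<k. - 1)"
    proof (intro prod.cong refl)
      fix j assume "j \<in> {1..<k}"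
      \<comment> \<open>For j < k, \<open>y j\<close> is at most \<open>x (Suc j)\<close>, and
        \<open>Suc j\<close> is still at most k.\<close>
      then show "sgn (y j - e) = - 1" using interlace(2)[of j] x_neg[of "Suc j"] k by auto
    qed
    finally show ?thesis by simp
  qed
  moreover have "(- 1 :: real) ^ k = - ((- 1) ^ (k - 1))"
    using k by (cases k) auto
  ultimately show ?thesis by simp
qed

end

section \<open>The polynomial sigma_(d-1) as a derivative, and the asymptotic subequations\<close>

context real_rooted_pencil
begin

definition \<sigma> :: "real^'n^'n \<Rightarrow> real" where
  "\<sigma> = garding_sigma d h (d - 1)"

text \<open>The subsets of size d - 1 are the complements of single indices, so the elementary
  symmetric function of the shifted eigenvalues is the product rule written out.\<close>

lemma sigma_eq_pderiv:
  assumes A: "A \<in> Sym2" and "1 \<le> d"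
  shows "\<sigma> (t *\<^sub>R mat 1 + A) = poly (pderiv (\<Prod>j=1..d. [:ev j A, 1:])) t"
proof -
  have bij: "bij_betw (\<lambda>i. {1..d} - {i}) {1..d} {S. S \<subseteq> {1..d} \<and> card S = d - 1}"
  proof (rule bij_betw_imageI)
    show "inj_on (\<lambda>i. {1..d} - {i}) {1..d}" by (rule inj_onI) blast
    show "(\<lambda>i. {1..d} - {i}) ` {1..d} = {S. S \<subseteq> {1..d} \<and> card S = d - 1}"
    proof (intro equalityI subsetI)
      fix S assume "S \<in> {S. S \<subseteq> {1..d} \<and> card S = d - 1}"
      then have S: "S \<subseteq> {1..d}" "card S = d - 1" by auto
      then have "card ({1..d} - S) = 1"
        using \<open>1 \<le> d\<close> by (simp add: card_Diff_subset finite_subset)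
      then obtain i where "{1..d} - S = {i}" by (auto simp: card_1_singleton_iff)
      with S(1) have "i \<in> {1..d}" "S = {1..d} - {i}" by blast+
      then show "S \<in> (\<lambda>i. {1..d} - {i}) ` {1..d}" by blast
    qed auto
  qed
  have "\<sigma> (t *\<^sub>R mat 1 + A) =
      (\<Sum>S | S \<subseteq> {1..d} \<and> card S = d - 1. \<Prod>k\<in>S. ev k A + t)"
    unfolding \<sigma>_def garding_sigma_def
    using A by (intro sum.cong prod.cong refl) (auto simp: ev_shift subset_iff)
  also have "\<dots> = (\<Sum>i=1..d. \<Prod>k\<in>{1..d} - {i}. ev k A + t)"
    by (rule sum.reindex_bij_betw[OF bij, symmetric])
  also have "\<dots> = poly (pderiv (\<Prod>j=1..d. [:ev j A, 1:])) t"
    by (simp add: pderiv_prod pderiv_pCons poly_sum poly_prod)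
  finally show ?thesis .
qed

text \<open>Makes the results on pencils available for \<open>\<sigma>\<close> and the interlacing
  results available on each line tI + A.\<close>

lemma
  assumes "1 \<le> d"
  shows real_rooted_pencil_sigma: "real_rooted_pencil \<sigma> (d - 1) (real d)"
    and derivative_roots_sigma: "A \<in> Sym2 \<Longrightarrow>
      derivative_roots d (\<lambda>j. ev j A) (\<lambda>j. garding_eigenvalue \<sigma> j A) (real d)"
proof -
  define p where "p A = (\<Prod>j=1..d. [:ev j A, 1:])" for A
  have p: "degree (p A) = d" "lead_coeff (p A) = 1" "size (proots (p A)) = d" for A
    using monic_prod_linear[of "\<lambda>j. ev j A" "{1..d}"]
    by (simp_all add: p_def proots_prod_linear)
  have deg: "degree (pderiv (p A)) = d - 1" for A
    by (simp add: degree_pderiv p)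
  have lc: "lead_coeff (pderiv (p A)) = real d" for A
    using p[of A] assms by (simp add: deg coeff_pderiv)
  \<comment> \<open>On the whole line differentiation loses at most one of the d real roots, and the
    degree forbids more than d - 1.\<close>
  have size: "size (proots (pderiv (p A))) = d - 1" for A
  proof (rule antisym)
    show "size (proots (pderiv (p A))) \<le> d - 1"
      using size_proots_le[of "pderiv (p A)"] by (simp add: deg)
    have "pderiv (p A) \<noteq> 0" using lc[of A] assms by auto
    from size_roots_pderiv_ge[OF this, of UNIV] show "d - 1 \<le> size (proots (pderiv (p A)))"
      by (simp add: p)
  qed
  have sigma: "\<sigma> (t *\<^sub>R mat 1 + A) = poly (pderiv (p A)) t" if "A \<in> Sym2" for A t
    unfolding p_def by (rule sigma_eq_pderiv[OF that assms])
  have fact: "\<sigma> (t *\<^sub>R mat 1 + A) = real d * (\<Prod>j=1..d - 1. t + garding_eigenvalue \<sigma> j A)"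
    if "A \<in> Sym2" for A t
    using garding_eigenvalue_factorization[of \<sigma> A "pderiv (p A)" t] sigma[OF that] size[of A]
    by (simp only: deg lc[unfolded deg])
  have mono_sigma: "mono_on {1..d - 1} (\<lambda>j. garding_eigenvalue \<sigma> j A)" if "A \<in> Sym2" for A
    using mono_garding_eigenvalue[of \<sigma> A "pderiv (p A)"] sigma[OF that] size[of A]
    by (simp only: deg)
  show "real_rooted_pencil \<sigma> (d - 1) (real d)"
  proof
    \<comment> \<open>\<open>\<sigma>\<close> is a polynomial in the ordered eigenvalues of
      \<open>h\<close>, which are continuous.\<close>
    show "continuous_on Sym2 \<sigma>"
      unfolding \<sigma>_def garding_sigma_def
      by (intro continuous_on_sum continuous_on_prod continuous_on_ev) auto
    show "\<sigma> (s *\<^sub>R A) = s ^ (d - 1) * \<sigma> A" if "A \<in> Sym2" "0 < s" for A s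
    proof -
      have "\<sigma> (s *\<^sub>R A) = (\<Sum>S | S \<subseteq> {1..d} \<and> card S = d - 1. \<Prod>k\<in>S. s * ev k A)"
        unfolding \<sigma>_def garding_sigma_def
        using that by (intro sum.cong prod.cong refl) (auto simp: ev_scale subset_iff)
      then show ?thesis
        by (simp add: \<sigma>_def garding_sigma_def prod.distrib sum_distrib_left)
    qed
  qed (use assms fact mono_sigma in auto)
  show "derivative_roots d (\<lambda>j. ev j A) (\<lambda>j. garding_eigenvalue \<sigma> j A) (real d)"
    if A: "A \<in> Sym2"
  proof
    show "pderiv (\<Prod>j=1..d. [:ev j A, 1:]) =
        smult (real d) (\<Prod>j=1..d - 1. [:garding_eigenvalue \<sigma> j A, 1:])"
      (is "?l = ?r")
    proof -
      have "poly ?l t = poly ?r t" for t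
        using sigma[OF A, of t] fact[OF A, of t] by (simp add: p_def poly_prod add.commute)
      then show ?thesis by (simp flip: poly_eq_poly_eq_iff add: fun_eq_iff)
    qed
  qed (use assms mono[OF A] mono_sigma[OF A] in auto)
qed

theorem asymptotic_subequation_arctan_set:
  assumes k: "k \<in> {1..d}"
    and "\<theta> \<in> {(real d - 2 * real k) * (pi / 2) <..< (real d - 2 * (real k - 1)) * (pi / 2)}"
  shows "asymptotic_subequation (arctan_set d h \<theta>) = garding_branch h k"
proof -
  have "asymptotic_interior (arctan_set d h \<theta>) = {A \<in> Sym2. 0 < ev k A}"
    unfolding asymptotic_interior_arctan_set
    using eventually_sum_arctan_iff_nondegenerate[OF mono assms] by (intro Collect_cong conj_cong refl)
  then show ?thesis
    by (simp add: asymptotic_subequation_def closure_ev_pos[OF k])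
qed

text \<open>The asymptotic interior is where the k-th eigenvalue of \<open>\<sigma>\<close> is
  positive. As \<open>\<sigma>\<close> is itself a real-rooted pencil, \<open>closure_ev_pos\<close>
  for \<open>\<sigma>\<close> gives the closure.\<close>

theorem asymptotic_subequation_arctan_set_critical:
  assumes k: "k \<in> {1..d - 1}"
  shows "asymptotic_subequation (arctan_set d h ((real d - 2 * real k) * (pi / 2))) =
    garding_branch (garding_sigma d h (d - 1)) k"
proof -
  have d: "1 \<le> d" using k by auto
  interpret \<sigma>: real_rooted_pencil \<sigma> "d - 1" "real d"
    by (rule real_rooted_pencil_sigma[OF d])
  have "(\<exists>e>0. \<forall>\<^sub>F t in at_top.
      (real d - 2 * real k) * (pi / 2) \<le> (\<Sum>j=1..d. arctan (t * (ev j A - e)))) \<longleftrightarrow>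
      0 < garding_eigenvalue \<sigma> k A" if A: "A \<in> Sym2" for A
  proof -
    interpret derivative_roots d "\<lambda>j. ev j A" "\<lambda>j. garding_eigenvalue \<sigma> j A" "real d"
      by (rule derivative_roots_sigma[OF d A])
    show ?thesis
      by (rule eventually_sum_arctan_iff_critical[where y = "\<lambda>j. \<sigma>.ev j A",
            OF mono_x k interlace(2,1)[OF k] sgn_sum_inverse[OF k]])
  qed
  then have "asymptotic_interior (arctan_set d h ((real d - 2 * real k) * (pi / 2))) =
      {A \<in> Sym2. 0 < garding_eigenvalue \<sigma> k A}"
    unfolding asymptotic_interior_arctan_set by (intro Collect_cong conj_cong refl)
  then show ?thesis
    unfolding asymptotic_subequation_def \<sigma>_def[symmetric] by (simp only: \<sigma>.closure_ev_pos[OF k])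
qed

end

theorem mainTheorem7:
  fixes g :: "real^'n^'n \<Rightarrow> real" and m :: nat and \<theta> :: real
  assumes "garding_dirichlet m g"
    and "\<theta> \<in> {- (real m * (pi / 2)) <..< real m * (pi / 2)}"
  shows "(\<forall>k\<in>{1..m}.
            \<theta> \<in> {(real m - 2 * real k) * (pi / 2) <..< (real m - 2 * (real k - 1)) * (pi / 2)} \<longrightarrow>
            asymptotic_subequation (arctan_set m g \<theta>) = garding_branch g k) \<and>
         (\<forall>k\<in>{1..m - 1}.
            \<theta> = (real m - 2 * real k) * (pi / 2) \<longrightarrow>
            asymptotic_subequation (arctan_set m g \<theta>) =
              garding_branch (garding_sigma m g (m - 1)) k)"
proof -
  interpret real_rooted_pencil g m "g (mat 1)"
    using assms(1) by (intro real_rooted_pencil_garding_hyperbolic) (simp add: garding_dirichlet_def)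
  show ?thesis
    using asymptotic_subequation_arctan_set asymptotic_subequation_arctan_set_critical by blast
qed

end
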